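(* For each fixed integer $n\geq6$, as $\epsilon\downarrow0$, $$\min_{\omega\in\mathcal{C}_n(d_{\max}(4)+\epsilon)}K_n(\omega)=\frac34+\frac{3\sqrt[4]{4-2\sqrt2}}{8}\sqrt{\epsilon}+O(\epsilon),$$ where $d_{\max}(4)=\sqrt{2-\sqrt2}$.
   Context: Let $\epsilon_1,\dots,\epsilon_n$ be independent Rademacher random variables (uniform on $\{-1,1\}$; not to be confused with the real parameter $\epsilon>0$). For $\omega\in\mathbb R^n$ put $K_n(\omega)=\mathbb E\left|\sum_{i=1}^n\omega_i\epsilon_i\right|$. A vector $\omega\in\mathbb R^n$ is called a proper unit vector if $\|\omega\|_2=1$ and $\omega_1\ge\omega_2\ge\cdots\ge\omega_n\ge0$. Let $\omega^*=(1/\sqrt2,1/\sqrt2,0,\dots,0)\in\mathbb R^n$ and, for $\tau\ge0$, let $\mathcal C_n(\tau)$ be the set of proper unit vectors $\omega\in\mathbb R^n$ with $\|\omega-\omega^*\|_2=\tau$. *)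

theory Defs
  imports "HOL-Probability.Probability" "HOL-Library.Landau_Symbols"
begin

(* A vector of R^n is an element of {1..n} \<rightarrow>\<^sub>E UNIV: a function on nat that is
   arbitrary on {1..n} and takes the fixed value undefined elsewhere. *)

definition rademacher :: "real pmf" where
  "rademacher = pmf_of_set {-1, 1}"

(* The product pmf on {1..n} makes the coordinates e 1, ..., e n independent Rademacher
   variables; the 0 is only the value of e outside {1..n}. *)
definition K :: "nat \<Rightarrow> (nat \<Rightarrow> real) \<Rightarrow> real" where
  "K n \<omega> = measure_pmf.expectation (Pi_pmf {1..n} 0 (\<lambda>_. rademacher)) (\<lambda>e. \<bar>\<Sum>i=1..n. \<omega> i * e i\<bar>)"

definition proper_unit_vector :: "nat \<Rightarrow> (nat \<Rightarrow> real) \<Rightarrow> bool" where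
  "proper_unit_vector n \<omega> \<longleftrightarrow>
     \<omega> \<in> {1..n} \<rightarrow>\<^sub>E UNIV \<and>
     L2_set \<omega> {1..n} = 1 \<and>
     (\<forall>i\<in>{1..<n}. \<omega> i \<ge> \<omega> (i + 1)) \<and> \<omega> n \<ge> 0"

definition omega_star :: "nat \<Rightarrow> real" where
  "omega_star i = (if i = 1 \<or> i = 2 then 1 / sqrt 2 else 0)"

definition C :: "nat \<Rightarrow> real \<Rightarrow> (nat \<Rightarrow> real) set" where
  "C n \<tau> = {\<omega>. proper_unit_vector n \<omega> \<and> L2_set (\<lambda>i. \<omega> i - omega_star i) {1..n} = \<tau>}"

definition d_max_4 :: real where
  "d_max_4 = sqrt (2 - sqrt 2)"

end

theory Submission
  imports Defs
begin

text \<open>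
  Since \<open>\<parallel>\<omega> - \<omega>\<^sup>*\<parallel>\<^sup>2 = 2 - sqrt 2 (\<omega> 1 + \<omega> 2)\<close> for a unit vector, the constraint
  \<open>\<parallel>\<omega> - \<omega>\<^sup>*\<parallel> = d_max_4 + \<epsilon>\<close> says \<open>\<omega> 1 + \<omega> 2 = 1 - \<delta>\<close> with
  \<open>\<delta> = sqrt (4 - 2 sqrt 2) \<epsilon> + O(\<epsilon>\<^sup>2)\<close>. So it is enough to show that the minimum is
  \<open>3/4 + 3/8 sqrt \<delta> + O(\<delta>)\<close>.

  The value is attained up to \<open>O(\<delta>)\<close> by \<open>(b, b, b, b, t, t, 0, ...)\<close> with \<open>b = (1 - \<delta>) / 2\<close>:
  here \<open>t\<close> is about \<open>sqrt \<delta>\<close>, and the two small weights are felt only when the four signs in front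
  of \<open>b\<close> cancel, which has probability \<open>3/8\<close> (\<open>K_upper_bound\<close>).

  The lower bound rests on Szarek's sharp inequality \<open>E\<bar>\<Sum> w\<^sub>i \<epsilon>\<^sub>i\<bar> \<ge> \<parallel>w\<parallel> / sqrt 2\<close>
  (\<open>szarek_khintchine\<close>), proved following Latala and Oleszkiewicz by a Poincare inequality with
  the improved constant \<open>2\<close> for even functions on the cube. Let \<open>D\<close> be
  \<open>2 - (\<omega> 1 + \<omega> 2 + \<omega> 3 + \<omega> 4)\<close>, which measures the distance from \<open>(1/2, 1/2, 1/2, 1/2, 0, ...)\<close>
  and is at least \<open>2 \<delta>\<close>.

  \<^item> If \<open>D\<close> is small (\<open>near_lower_bound\<close>), split off the first four weights. The remaining
    weights have square sum at least \<open>D - 2 D\<^sup>2\<close>, so Szarek's inequality for them gives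
    \<open>K \<ge> 3/8 (2 - D) + 3/8 sqrt (D / 2) - O(D\<^sup>2)\<close>, which is smallest at \<open>D = 2 \<delta>\<close>.
  \<^item> If \<open>D\<close> is not small (\<open>far_lower_bound\<close>), condition on whether the first two signs agree.
    If they do, the mean is at least \<open>\<omega> 1 + \<omega> 2\<close>, which is about \<open>1\<close>; if they do not, Szarek's
    inequality bounds the mean below by about \<open>1/2\<close>. The average is already \<open>3/4\<close> up to \<open>O(\<delta>)\<close>,
    and one of the two estimates gains a constant: the second if \<open>\<omega> 1 - \<omega> 2\<close> is not small, and
    the first otherwise, because the remaining weights then add up to more than \<open>\<omega> 1 + \<omega> 2\<close> and can
    overpower it with positive probability. That constant depends on \<open>n\<close> but not on \<open>\<delta>\<close>.

  The minimum exists because the constraint set is compact and \<open>K n\<close> is continuous.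
\<close>

section \<open>Means over the sign cube\<close>

text \<open>
  The mean of \<open>f (\<Sum> w\<^sub>i \<epsilon>\<^sub>i)\<close> over all sign patterns. Conditioning on one sign at a time turns
  every statement about the cube into a list induction in which \<open>f\<close> varies.
\<close>
primrec signed_mean :: "real list \<Rightarrow> (real \<Rightarrow> real) \<Rightarrow> real" where
  "signed_mean [] f = f 0"
| "signed_mean (w # ws) f =
     (signed_mean ws (\<lambda>z. f (z + w)) + signed_mean ws (\<lambda>z. f (z - w))) / 2"

text \<open>
  The Dirichlet form of the cube: \<open>\<Sum>\<^sub>i E ((F(x) - F(x\<^sup>i)) / 2)\<^sup>2\<close> for
  \<open>F(x) = f (\<Sum> w\<^sub>i x\<^sub>i)\<close>, where \<open>x\<^sup>i\<close> is \<open>x\<close> with the \<open>i\<close>-th sign flipped.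
\<close>
primrec flip_energy :: "real list \<Rightarrow> (real \<Rightarrow> real) \<Rightarrow> real" where
  "flip_energy [] f = 0"
| "flip_energy (w # ws) f =
     (flip_energy ws (\<lambda>z. f (z + w)) + flip_energy ws (\<lambda>z. f (z - w))) / 2
     + signed_mean ws (\<lambda>z. ((f (z + w) - f (z - w)) / 2)\<^sup>2)"

lemma signed_mean_add:
  "signed_mean ws (\<lambda>z. f z + g z) = signed_mean ws f + signed_mean ws g"
  by (induction ws arbitrary: f g) (simp_all add: field_simps)

lemma signed_mean_mult:
  "signed_mean ws (\<lambda>z. c * f z) = c * signed_mean ws f"
  by (induction ws arbitrary: f) (simp_all add: field_simps)

lemma signed_mean_const: "signed_mean ws (\<lambda>z. c) = c"
  by (induction ws) simp_all

lemma signed_mean_mono: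
  "(\<And>z. f z \<le> g z) \<Longrightarrow> signed_mean ws f \<le> signed_mean ws g"
proof (induction ws arbitrary: f g)
  case (Cons w ws)
  from Cons.IH[of "\<lambda>z. f (z + w)" "\<lambda>z. g (z + w)"] Cons.IH[of "\<lambda>z. f (z - w)" "\<lambda>z. g (z - w)"]
  show ?case using Cons.prems by simp
qed simp

lemma signed_mean_ident: "signed_mean ws (\<lambda>z. z + c) = c"
proof (induction ws arbitrary: c)
  case (Cons w ws)
  from Cons[of "w + c"] Cons[of "c - w"] show ?case by (simp add: algebra_simps)
qed simp

lemma signed_mean_reflect: "signed_mean ws (\<lambda>z. f (- z)) = signed_mean ws f"
proof (induction ws arbitrary: f)
  case (Cons w ws)
  from Cons[of "\<lambda>z. f (z - w)"] Cons[of "\<lambda>z. f (z + w)"]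
  show ?case by (simp add: algebra_simps)
qed simp

lemma signed_mean_square_shift:
  "signed_mean ws (\<lambda>z. (z + c)\<^sup>2) = (\<Sum>w\<leftarrow>ws. w\<^sup>2) + c\<^sup>2"
proof (induction ws arbitrary: c)
  case (Cons w ws)
  from Cons[of "w + c"] Cons[of "c - w"]
  show ?case by (simp add: algebra_simps power2_eq_square)
qed simp

lemma signed_mean_square_split:
  "signed_mean ws (\<lambda>z. ((f z + g z) / 2)\<^sup>2) + signed_mean ws (\<lambda>z. ((f z - g z) / 2)\<^sup>2)
   = (signed_mean ws (\<lambda>z. (f z)\<^sup>2) + signed_mean ws (\<lambda>z. (g z)\<^sup>2)) / 2"
proof -
  have "((f z + g z) / 2)\<^sup>2 + ((f z - g z) / 2)\<^sup>2 = (1/2) * ((f z)\<^sup>2 + (g z)\<^sup>2)" for z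
    by (simp add: power2_eq_square field_simps)
  then show ?thesis
    by (simp only: signed_mean_add[symmetric] signed_mean_mult)
qed

lemma signed_mean_average:
  "(signed_mean ws f + signed_mean ws g) / 2 = signed_mean ws (\<lambda>z. (f z + g z) / 2)"
  using signed_mean_mult[of ws "1/2" "\<lambda>z. f z + g z"] by (simp add: signed_mean_add)

section \<open>Szarek's inequality\<close>

text \<open>
  The parallelogram law. It relates the energies of \<open>f (z \<plusminus> w)\<close> to those of the parts of \<open>f\<close> that
  are even and odd in one sign, which is what the inductive steps below decompose into.
\<close>
lemma flip_energy_split:
  "flip_energy ws (\<lambda>z. (f z + g z) / 2) + flip_energy ws (\<lambda>z. (f z - g z) / 2)
   = (flip_energy ws f + flip_energy ws g) / 2"
proof (induction ws arbitrary: f g)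
  case (Cons w ws)
  let ?F = "\<lambda>z. (f (z + w) - f (z - w)) / 2" and ?G = "\<lambda>z. (g (z + w) - g (z - w)) / 2"
  have "((f (z + w) + g (z + w)) / 2 - (f (z - w) + g (z - w)) / 2) / 2 = (?F z + ?G z) / 2"
       "((f (z + w) - g (z + w)) / 2 - (f (z - w) - g (z - w)) / 2) / 2 = (?F z - ?G z) / 2" for z
    by (simp_all add: field_simps)
  then show ?case
    using Cons[of "\<lambda>z. f (z + w)" "\<lambda>z. g (z + w)"] Cons[of "\<lambda>z. f (z - w)" "\<lambda>z. g (z - w)"]
      signed_mean_square_split[of ws ?F ?G]
    by (simp only: flip_energy.simps) argo
qed simp

lemma flip_energy_nonneg: "0 \<le> flip_energy ws f"
proof (induction ws arbitrary: f)
  case (Cons w ws)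
  have "0 \<le> signed_mean ws (\<lambda>z. ((f (z + w) - f (z - w)) / 2)\<^sup>2)"
    using signed_mean_mono[of "\<lambda>z. 0"] by (simp add: signed_mean_const)
  then show ?case using Cons by simp
qed simp

text \<open>
  The spectral gap \<open>1\<close> of the cube. The part \<open>?h\<close> that is odd in the first sign adds its mean square
  both to the variance and to the energy, so only the even part \<open>?g\<close> needs the induction hypothesis.
\<close>
lemma poincare:
  "signed_mean ws (\<lambda>z. (f z)\<^sup>2) - (signed_mean ws f)\<^sup>2 \<le> flip_energy ws f"
proof (induction ws arbitrary: f)
  case (Cons w ws)
  let ?p = "\<lambda>z. f (z + w)" and ?m = "\<lambda>z. f (z - w)"
  let ?g = "\<lambda>z. (?p z + ?m z) / 2" and ?h = "\<lambda>z. (?p z - ?m z) / 2"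
  show ?case
    using Cons[of ?g] flip_energy_nonneg[of ws ?h] signed_mean_square_split[of ws ?p ?m]
      flip_energy_split[of ws ?p ?m]
      signed_mean_average[of ws "\<lambda>z. (?p z)\<^sup>2" "\<lambda>z. (?m z)\<^sup>2"]
    unfolding signed_mean.simps flip_energy.simps signed_mean_average by argo
qed simp

lemma signed_mean_odd:
  assumes "\<And>z. f (- z) = - f z"
  shows "signed_mean ws f = 0"
  using signed_mean_reflect[of ws f] signed_mean_mult[of ws "-1" f] assms by simp

text \<open>
  An even function has no component on the eigenspace of \<open>1\<close>, so its gap is \<open>2\<close>. Without Fourier
  analysis: \<open>?g\<close> is again even and inherits the constant \<open>2\<close> by induction, while \<open>?h\<close> is odd and has
  mean \<open>0\<close>; its mean square is counted once in the energy directly and once by the ordinary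
  Poincare inequality.
\<close>
lemma poincare_even:
  assumes "\<And>z. f (- z) = f z"
  shows "2 * (signed_mean ws (\<lambda>z. (f z)\<^sup>2) - (signed_mean ws f)\<^sup>2) \<le> flip_energy ws f"
  using assms
proof (induction ws arbitrary: f)
  case (Cons w ws)
  let ?p = "\<lambda>z. f (z + w)" and ?m = "\<lambda>z. f (z - w)"
  let ?g = "\<lambda>z. (?p z + ?m z) / 2" and ?h = "\<lambda>z. (?p z - ?m z) / 2"
  have swap1: "f (- z + w) = f (z - w)" for z
    using Cons.prems[of "z - w"] by simp
  have swap2: "f (- z - w) = f (z + w)" for z
    using Cons.prems[of "z + w"] by simp
  have even: "2 * (signed_mean ws (\<lambda>z. (?g z)\<^sup>2) - (signed_mean ws ?g)\<^sup>2) \<le> flip_energy ws ?g"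
    by (rule Cons.IH) (simp only: swap1 swap2, simp only: add.commute)
  have odd: "signed_mean ws ?h = 0"
    by (rule signed_mean_odd) (simp only: swap1 swap2 minus_divide_left minus_diff_eq)
  show ?case
    using even poincare[of ws ?h] signed_mean_square_split[of ws ?p ?m]
      flip_energy_split[of ws ?p ?m]
      signed_mean_average[of ws "\<lambda>z. (?p z)\<^sup>2" "\<lambda>z. (?m z)\<^sup>2"]
    unfolding signed_mean.simps flip_energy.simps signed_mean_average odd by (simp only: power_zero_numeral) argo
qed simp

text \<open>Flipping the sign of \<open>w\<close> moves the argument by \<open>2 w\<close>, so it contributes at most \<open>w\<^sup>2\<close>.\<close>
lemma flip_energy_lipschitz:
  assumes "\<And>x y. \<bar>f x - f y\<bar> \<le> \<bar>x - y\<bar>"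
  shows "flip_energy ws f \<le> (\<Sum>w\<leftarrow>ws. w\<^sup>2)"
  using assms
proof (induction ws arbitrary: f)
  case (Cons w ws)
  have sq: "((f (z + w) - f (z - w)) / 2)\<^sup>2 \<le> w\<^sup>2" for z
    using Cons.prems[of "z + w" "z - w"] by (subst abs_le_square_iff[symmetric]) simp
  have "flip_energy ws (\<lambda>z. f (z + w)) \<le> (\<Sum>w\<leftarrow>ws. w\<^sup>2)"
    by (rule Cons.IH) (use Cons.prems[of "_ + w" "_ + w"] in simp)
  moreover have "flip_energy ws (\<lambda>z. f (z - w)) \<le> (\<Sum>w\<leftarrow>ws. w\<^sup>2)"
    by (rule Cons.IH) (use Cons.prems[of "_ - w" "_ - w"] in simp)
  moreover have "signed_mean ws (\<lambda>z. ((f (z + w) - f (z - w)) / 2)\<^sup>2) \<le> w\<^sup>2"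
    using signed_mean_mono[of _ "\<lambda>z. w\<^sup>2" ws, OF sq] by (simp add: signed_mean_const)
  ultimately show ?case by (simp only: flip_energy.simps list.map sum_list.Cons) argo
qed simp

text \<open>
  For \<open>f = abs\<close> the mean square and the energy bound are both the square sum \<open>V\<close> of the weights,
  so \<open>2 (V - (E\<bar>\<dots>\<bar>)\<^sup>2) \<le> V\<close>.
\<close>
theorem szarek_khintchine:
  "sqrt ((\<Sum>w\<leftarrow>ws. w\<^sup>2) / 2) \<le> signed_mean ws abs"
proof (rule real_le_lsqrt)
  show "(\<Sum>w\<leftarrow>ws. w\<^sup>2) / 2 \<le> (signed_mean ws abs)\<^sup>2"
    using poincare_even[of abs ws] flip_energy_lipschitz[of abs ws, OF abs_triangle_ineq3]
      signed_mean_square_shift[of ws 0] by simp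
  show "0 \<le> signed_mean ws abs"
    using signed_mean_mono[of "\<lambda>z. 0" abs ws] by (simp add: signed_mean_const)
qed

section \<open>Splitting off large weights\<close>
lemma signed_mean_abs_ge_shift: "\<bar>c\<bar> \<le> signed_mean ws (\<lambda>z. \<bar>z + c\<bar>)"
proof -
  have "c \<le> signed_mean ws (\<lambda>z. \<bar>z + c\<bar>)"
    using signed_mean_mono[of "\<lambda>z. z + c" "\<lambda>z. \<bar>z + c\<bar>" ws] signed_mean_ident[of ws c] by simp
  moreover have "- c \<le> signed_mean ws (\<lambda>z. \<bar>z + c\<bar>)"
    using signed_mean_mono[of "\<lambda>z. (-1) * (z + c)" "\<lambda>z. \<bar>z + c\<bar>" ws] signed_mean_ident[of ws c]
    unfolding signed_mean_mult by simp
  ultimately show ?thesis by linarith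
qed

lemma signed_mean_abs_shift_minus:
  "signed_mean ws (\<lambda>z. \<bar>z - c\<bar>) = signed_mean ws (\<lambda>z. \<bar>z + c\<bar>)"
proof -
  have "(\<lambda>z::real. \<bar>- z - c\<bar>) = (\<lambda>z. \<bar>z + c\<bar>)" by auto
  then show ?thesis using signed_mean_reflect[of ws "\<lambda>z. \<bar>z - c\<bar>"] by simp
qed

text \<open>By symmetry the shifted mean is that of \<open>(\<bar>z + c\<bar> + \<bar>z - c\<bar>) / 2 = max \<bar>z\<bar> \<bar>c\<bar>\<close>.\<close>
lemma signed_mean_abs_shift_ge:
  "signed_mean ws abs \<le> signed_mean ws (\<lambda>z. \<bar>z + c\<bar>)"
proof -
  have "signed_mean ws (\<lambda>z. 2 * \<bar>z\<bar>) \<le> signed_mean ws (\<lambda>z. \<bar>z + c\<bar> + \<bar>z - c\<bar>)"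
    by (rule signed_mean_mono) arith
  then show ?thesis
    unfolding signed_mean_add signed_mean_mult signed_mean_abs_shift_minus by simp
qed

lemma signed_mean_ge_all_minus:
  assumes "\<And>z. 0 \<le> f z"
  shows "f (- sum_list ws) / 2 ^ length ws \<le> signed_mean ws f"
  using assms
proof (induction ws arbitrary: f)
  case (Cons w ws)
  have "0 \<le> signed_mean ws (\<lambda>z. f (z + w))"
    using signed_mean_mono[of "\<lambda>z. 0" "\<lambda>z. f (z + w)" ws] Cons.prems
    by (simp add: signed_mean_const)
  moreover have "f (- sum_list (w # ws)) / 2 ^ length ws \<le> signed_mean ws (\<lambda>z. f (z - w))"
  proof -
    have "- sum_list (w # ws) = - sum_list ws - w" by simp
    then show ?thesis using Cons.IH[of "\<lambda>z. f (z - w)"] Cons.prems by (simp only:)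
  qed
  ultimately show ?case by simp
qed simp

text \<open>
  Improves the trivial bound \<open>c\<close> by the event that all signs are negative, where \<open>z + c\<close> is negative.
\<close>
lemma signed_mean_abs_shift_overshoot:
  assumes "c \<le> sum_list ws"
  shows "c + 2 * ((sum_list ws - c) / 2 ^ length ws) \<le> signed_mean ws (\<lambda>z. \<bar>z + c\<bar>)"
proof -
  let ?m = "signed_mean ws (\<lambda>z. max 0 (- z - c))"
  have "\<bar>z + c\<bar> = (z + c) + 2 * max 0 (- z - c)" for z
    by (simp add: abs_if max_def)
  then have "signed_mean ws (\<lambda>z. \<bar>z + c\<bar>) = signed_mean ws (\<lambda>z. (z + c) + 2 * max 0 (- z - c))"
    by presburger
  also have "\<dots> = c + 2 * ?m"
    using signed_mean_add[of ws "\<lambda>z. z + c" "\<lambda>z. 2 * max 0 (- z - c)"]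
    by (simp only: signed_mean_mult signed_mean_ident)
  finally have eq: "signed_mean ws (\<lambda>z. \<bar>z + c\<bar>) = c + 2 * ?m" .
  have "(sum_list ws - c) / 2 ^ length ws \<le> ?m"
    using signed_mean_ge_all_minus[of "\<lambda>z. max 0 (- z - c)" ws] assms by simp
  then show ?thesis unfolding eq by argo
qed

text \<open>
  If the first two signs agree, they act as a shift by \<open>a + b\<close>; if not, as one sign with weight
  \<open>a - b\<close>.
\<close>
lemma signed_mean_merge_two:
  "signed_mean (a # b # ws) abs
   = (signed_mean ws (\<lambda>z. \<bar>z + (a + b)\<bar>) + signed_mean ((a - b) # ws) abs) / 2"
proof -
  have e: "(\<lambda>z::real. \<bar>z + b + a\<bar>) = (\<lambda>z. \<bar>z + (a + b)\<bar>)"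
    "(\<lambda>z::real. \<bar>z - b + a\<bar>) = (\<lambda>z. \<bar>z + (a - b)\<bar>)"
    "(\<lambda>z::real. \<bar>z + b - a\<bar>) = (\<lambda>z. \<bar>z - (a - b)\<bar>)"
    "(\<lambda>z::real. \<bar>z - b - a\<bar>) = (\<lambda>z. \<bar>z - (a + b)\<bar>)"
    by (auto simp: algebra_simps)
  show ?thesis unfolding signed_mean.simps e signed_mean_abs_shift_minus by simp
qed

text \<open>
  If at least three of the first four signs agree, the mean over the other signs is estimated by
  the signed sum of \<open>a, b, c, d\<close>, counted with the majority sign; in the six balanced patterns
  this sum is discarded in favour of the remaining weights. Nothing is lost when
  \<open>a = b = c = d\<close> and the remaining weights are small.
\<close>
lemma signed_mean_four_lower:
  "3 / 8 * (a + b + c + d) + 3 / 8 * signed_mean ws abs \<le> signed_mean (a # b # c # d # ws) abs"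
proof -
  let ?N = "\<lambda>x. signed_mean ws (\<lambda>z. \<bar>z + x\<bar>)"
  \<comment> \<open>One of these three estimates is used for each of the 16 sign patterns of \<open>d, c, b, a\<close>.\<close>
  have pos: "x \<le> ?N x" and neg: "- x \<le> ?N x" and mid: "signed_mean ws abs \<le> ?N x" for x
    using signed_mean_abs_ge_shift[of x ws] signed_mean_abs_shift_ge[of ws x] by linarith+
  show ?thesis
    unfolding signed_mean.simps diff_conv_add_uminus add.assoc
    using pos[of "d + (c + (b + a))"] pos[of "- d + (c + (b + a))"]
      pos[of "d + (- c + (b + a))"] mid[of "- d + (- c + (b + a))"]
      pos[of "d + (c + (- b + a))"] mid[of "- d + (c + (- b + a))"]
      mid[of "d + (- c + (- b + a))"] neg[of "- d + (- c + (- b + a))"]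
      pos[of "d + (c + (b + - a))"] mid[of "- d + (c + (b + - a))"]
      mid[of "d + (- c + (b + - a))"] neg[of "- d + (- c + (b + - a))"]
      mid[of "d + (c + (- b + - a))"] neg[of "- d + (c + (- b + - a))"]
      neg[of "d + (- c + (- b + - a))"] neg[of "- d + (- c + (- b + - a))"]
    by argo
qed

section \<open>Lower bounds for vectors with first two weights summing to almost one\<close>

text \<open>
  With \<open>D = 2 - (a + b + p + q)\<close>, the first four weights deviate from \<open>1/2\<close> only by \<open>O(D)\<close>, so the
  normalization forces square sum at least \<open>D - 2 D\<^sup>2\<close> on the rest. Therefore the loss \<open>3/8 D\<close> in
  the large weights is outweighed by a gain of order \<open>sqrt D\<close>. In terms of \<open>u = sqrt (D / 2)\<close> the
  resulting bound is \<open>3/4 + 3/8 (u - 2 u\<^sup>2 - 4 u\<^sup>3)\<close>; the threshold \<open>D \<le> 1 / 18\<close> means \<open>u \<le> 1 / 6\<close>,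
  the range on which this is increasing, so that \<open>u\<close> may be replaced by its least value
  \<open>sqrt \<delta>\<close>.
\<close>
lemma near_lower_bound:
  fixes a b p q \<delta> :: real
  assumes order: "b \<le> a" "p \<le> b" "q \<le> p"
    and "0 \<le> \<delta>" and sum: "a + b = 1 - \<delta>"
    and near: "2 - (a + b + p + q) \<le> 1 / 18"
    and norm: "a\<^sup>2 + b\<^sup>2 + p\<^sup>2 + q\<^sup>2 + (\<Sum>w\<leftarrow>r. w\<^sup>2) = 1"
  shows "3 / 4 + 3 / 8 * sqrt \<delta> - 9 / 4 * \<delta> \<le> signed_mean (a # b # p # q # r) abs"
proof -
  define D v where "D = 2 - (a + b + p + q)" and "v = (\<Sum>w\<leftarrow>r. w\<^sup>2)"
  have D: "2 * \<delta> \<le> D" "D \<le> 1 / 18"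
    using order sum near by (auto simp: D_def)
  \<comment> \<open>Both differences are at most \<open>D - 2 * \<delta>\<close>, because \<open>q \<le> p \<le> b \<le> a\<close>.\<close>
  have c: "\<bar>a - b\<bar> \<le> \<bar>D\<bar>" and e: "\<bar>p - q\<bar> \<le> \<bar>D\<bar>"
    using order sum assms(4) by (auto simp: D_def)
  have "(a - b)\<^sup>2 \<le> D\<^sup>2" "(p - q)\<^sup>2 \<le> D\<^sup>2"
    using c e by (simp_all only: abs_le_square_iff)
  moreover have "\<delta>\<^sup>2 + (D - \<delta>)\<^sup>2 \<le> D\<^sup>2"
  proof -
    have "0 \<le> 2 * \<delta> * (D - \<delta>)" using D assms(4) by simp
    then show ?thesis by (simp add: power2_eq_square algebra_simps)
  qed
  moreover have "2 * v = 2 * D - (\<delta>\<^sup>2 + (D - \<delta>)\<^sup>2) - (a - b)\<^sup>2 - (p - q)\<^sup>2"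
  proof -
    have b: "b = 1 - \<delta> - a" and q: "q = 1 + \<delta> - D - p"
      using sum by (simp_all add: D_def)
    have "v = 1 - a\<^sup>2 - b\<^sup>2 - p\<^sup>2 - q\<^sup>2" using norm by (simp add: v_def)
    then show ?thesis unfolding b q by (simp add: power2_eq_square algebra_simps)
  qed
  ultimately have v: "D - 2 * D\<^sup>2 \<le> v" using zero_le_power2[of D] by linarith
  define u w where "u = sqrt (D / 2)" and "w = sqrt \<delta>"
  have u2: "D = 2 * u\<^sup>2" and w2: "\<delta> = w\<^sup>2" using D assms(4) by (simp_all add: u_def w_def)
  have w: "0 \<le> w" "w \<le> u" using D assms(4) by (simp_all add: u_def w_def)
  have "u \<le> sqrt ((1 / 6)\<^sup>2)" unfolding u_def using D by (intro real_sqrt_le_mono) (simp add: power2_eq_square)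
  then have u: "u \<le> 1 / 6" by simp
  have "u * (1 - 4 * u\<^sup>2) \<le> sqrt (v / 2)"
  proof (rule real_le_rsqrt)
    have u4: "u\<^sup>2 \<le> (1 / 6)\<^sup>2" using u w by (intro power_mono) auto
    have "(1 - 4 * u\<^sup>2) * (1 - 4 * u\<^sup>2) \<le> 1 * (1 - 4 * u\<^sup>2)"
      using u4 by (intro mult_right_mono) (auto simp: power2_eq_square)
    then have "u\<^sup>2 * ((1 - 4 * u\<^sup>2) * (1 - 4 * u\<^sup>2)) \<le> u\<^sup>2 * (1 - 4 * u\<^sup>2)"
      by (intro mult_left_mono) auto
    then show "(u * (1 - 4 * u\<^sup>2))\<^sup>2 \<le> v / 2"
      using v unfolding u2 by (simp add: power2_eq_square algebra_simps)
  qed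
  moreover have "w - 2 * w\<^sup>2 - 4 * w ^ 3 \<le> u - 2 * u\<^sup>2 - 4 * u ^ 3"
  proof -
    have "u * u \<le> 1/6 * (1/6)" "u * w \<le> 1/6 * (1/6)" "w * w \<le> 1/6 * (1/6)"
      using u w by (intro mult_mono; simp)+
    then have "0 \<le> 1 - 2 * (u + w) - 4 * (u * u + u * w + w * w)"
      using u w by simp
    then have "0 \<le> (u - w) * (1 - 2 * (u + w) - 4 * (u * u + u * w + w * w))"
      using w by simp
    then show ?thesis by (simp add: power2_eq_square power3_eq_cube algebra_simps)
  qed
  moreover have "4 * w ^ 3 \<le> 4 * w\<^sup>2" using u w by (simp add: power2_eq_square power3_eq_cube mult_left_le)
  moreover have "u * (1 - 4 * u\<^sup>2) = u - 4 * u ^ 3" by (simp add: power2_eq_square power3_eq_cube algebra_simps)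
  ultimately have "w - 6 * w\<^sup>2 \<le> sqrt (v / 2) - D" unfolding u2 by linarith
  moreover have "a + b + p + q = 2 - D" by (simp add: D_def)
  ultimately show ?thesis
    using signed_mean_four_lower[of a b p q r] szarek_khintchine[of r]
    unfolding v_def[symmetric] w2[symmetric] w_def[symmetric] by argo
qed

text \<open>
  Write \<open>s = a + b\<close> and \<open>c = a - b\<close>. Merging the first two signs gives
  \<open>K \<ge> s / 2 + sqrt (1 + c\<^sup>2) / 4\<close>, which suffices if \<open>c \<ge> 1 / 12\<close>. Otherwise the weights after the
  second have square sum close to \<open>1 / 2\<close>, the first of them is at most \<open>1 / 2\<close>, and the
  remaining ones are at most \<open>q\<close>, which is bounded away from \<open>1 / 2\<close>: so their sum \<open>X\<close> exceeds \<open>1\<close> by a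
  constant and the overshoot bound applies.
\<close>
lemma far_lower_bound:
  fixes a b p q \<delta> :: real
  assumes order: "b \<le> a" "p \<le> b" "q \<le> p" "\<And>w. w \<in> set r \<Longrightarrow> 0 \<le> w \<and> w \<le> q" "0 \<le> q"
    and "0 \<le> \<delta>" "\<delta> \<le> 1 / 72" and sum: "a + b = 1 - \<delta>"
    and far: "1 / 18 \<le> 2 - (a + b + p + q)"
    and norm: "a\<^sup>2 + b\<^sup>2 + p\<^sup>2 + q\<^sup>2 + (\<Sum>w\<leftarrow>r. w\<^sup>2) = 1"
  shows "3 / 4 - \<delta> / 2 + 1 / (1200 * 2 ^ (length r + 2)) \<le> signed_mean (a # b # p # q # r) abs"
proof -
  define s c v where "s = a + b" and "c = a - b" and "v = (\<Sum>w\<leftarrow>p # q # r. w\<^sup>2)"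
  have split: "a\<^sup>2 + b\<^sup>2 = (s\<^sup>2 + c\<^sup>2) / 2" by (simp add: s_def c_def power2_eq_square field_simps)
  have v: "v = 1 - (s\<^sup>2 + c\<^sup>2) / 2" using norm split by (simp add: v_def)
  have s: "s = 1 - \<delta>" "0 \<le> s" "s \<le> 1" using sum assms(6,7) by (simp_all add: s_def)
  have s2: "s\<^sup>2 \<le> 1" using s by (simp add: power_le_one)
  have "sqrt ((c\<^sup>2 + v) / 2) \<le> signed_mean (c # p # q # r) abs"
    using szarek_khintchine[of "c # p # q # r"] by (simp add: v_def)
  moreover have "sqrt ((1 + c\<^sup>2) / 4) \<le> sqrt ((c\<^sup>2 + v) / 2)"
    using s2 unfolding v by (intro real_sqrt_le_mono) (simp add: field_simps)
  ultimately have half: "sqrt (1 + c\<^sup>2) / 2 \<le> signed_mean (c # p # q # r) abs"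
    by (simp add: real_sqrt_divide)
  have merge: "signed_mean (a # b # p # q # r) abs
      = (signed_mean (p # q # r) (\<lambda>z. \<bar>z + s\<bar>) + signed_mean (c # p # q # r) abs) / 2"
    unfolding s_def c_def by (rule signed_mean_merge_two)
  show ?thesis
  proof (cases "1 / 12 \<le> c")
    case True
    then have "(1 / 12)\<^sup>2 \<le> c\<^sup>2" by (intro power_mono) auto
    then have "1 + 1 / 300 \<le> sqrt (1 + c\<^sup>2)"
      by (intro real_le_rsqrt) (simp add: power2_eq_square)
    moreover have "s \<le> signed_mean (p # q # r) (\<lambda>z. \<bar>z + s\<bar>)"
      using signed_mean_abs_ge_shift[of s "p # q # r"] by linarith
    moreover have "1 / (1200 * 2 ^ (length r + 2)) \<le> (1 / 1200 :: real)"
      by (intro divide_left_mono) (simp_all only: one_le_power mult_le_cancel_left1, simp_all)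
    ultimately show ?thesis using half merge s(1) by argo
  next
    case False
    \<comment> \<open>Each weight from \<open>q\<close> on satisfies \<open>w\<^sup>2 \<le> q * w\<close>; this turns the square sum into a sum.\<close>
    define X where "X = sum_list (p # q # r)"
    have "(\<Sum>w\<leftarrow>q # r. w\<^sup>2) \<le> (\<Sum>w\<leftarrow>q # r. q * w)"
      by (rule sum_list_mono) (use order in \<open>auto simp: power2_eq_square intro!: mult_right_mono\<close>)
    also have "\<dots> = q * (X - p)" by (simp add: sum_list_const_mult X_def distrib_left)
    finally have X: "v - p\<^sup>2 \<le> q * (X - p)" by (simp add: v_def)
    have half_p: "p \<le> 1 / 2" and q: "q \<le> 1 / 2 - 1 / 36 + \<delta> / 2"
      using order sum far assms(6) by linarith+
    have c0: "c\<^sup>2 \<le> (1 / 12)\<^sup>2" using False order by (intro power_mono) (auto simp: c_def)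
    have "p * (p - q) \<le> 1 / 2 * (1 / 2 - q)"
      using half_p order by (intro mult_mono) auto
    then have "p\<^sup>2 - p * q \<le> 1 / 4 - q / 2" by (simp add: power2_eq_square right_diff_distrib)
    moreover have "q * (X - p) = q * X - p * q" "q * (X - 1) = q * X - q"
      by (simp_all add: right_diff_distrib)
    ultimately have "1 / 4 - c\<^sup>2 / 2 - q / 2 \<le> q * (X - 1)"
      using X s2 unfolding v by argo
    moreover have "1 / 144 \<le> 1 / 4 - c\<^sup>2 / 2 - q / 2"
      using c0 q assms(7) by (simp add: power2_eq_square)
    ultimately have qX: "1 / 144 \<le> q * (X - 1)" by linarith
    have "0 \<le> X - 1"
      using qX order(5) mult_nonneg_nonpos[of q "X - 1"] by linarith
    then have "q * (X - 1) \<le> 1 / 2 * (X - 1)"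
      using half_p order by (intro mult_right_mono) auto
    with qX have "1 / 72 \<le> X - 1" by argo
    then have gain: "1 / 72 \<le> X - s" using s by simp
    have "1 / 72 / 2 ^ (length r + 2) \<le> (X - s) / 2 ^ (length r + 2)"
      using gain by (intro divide_right_mono) auto
    moreover have "s + 2 * ((X - s) / 2 ^ (length r + 2)) \<le> signed_mean (p # q # r) (\<lambda>z. \<bar>z + s\<bar>)"
      using signed_mean_abs_shift_overshoot[of s "p # q # r"] gain by (simp add: X_def)
    moreover have "1 \<le> sqrt (1 + c\<^sup>2)" by simp
    moreover have "1 / (1200 * 2 ^ (length r + 2)) \<le> (1 / 72 / 2 ^ (length r + 2) :: real)"
      by (simp add: divide_simps)
    ultimately show ?thesis using half merge s(1) by argo
  qed
qed

section \<open>The functional \<open>K\<close> and its domain\<close>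
lemma expectation_signed_sum:
  assumes "distinct xs"
  shows "measure_pmf.expectation (Pi_pmf (set xs) 0 (\<lambda>_. rademacher))
           (\<lambda>e. f (\<Sum>i\<in>set xs. \<omega> i * e i)) = signed_mean (map \<omega> xs) f"
  using assms
proof (induction xs arbitrary: f)
  case (Cons x xs)
  let ?P = "Pi_pmf (set xs) 0 (\<lambda>_. rademacher)"
  let ?Q = "\<lambda>y. map_pmf (\<lambda>e. e(x := y)) ?P"
  have fin: "finite (set_pmf ?P)"
    by (auto simp: set_Pi_pmf rademacher_def intro!: finite_PiE_dflt)
  have eq: "Pi_pmf (set (x # xs)) 0 (\<lambda>_. rademacher) = rademacher \<bind> ?Q"
    using Cons.prems by (simp add: Pi_pmf_insert' map_pmf_def)
  have coord: "measure_pmf.expectation (?Q y) (\<lambda>e. f (\<Sum>i\<in>set (x # xs). \<omega> i * e i))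
        = signed_mean (map \<omega> xs) (\<lambda>z. f (z + \<omega> x * y))" for y
  proof -
    have "(\<Sum>i\<in>set (x # xs). \<omega> i * (e(x := y)) i) = (\<Sum>i\<in>set xs. \<omega> i * e i) + \<omega> x * y" for e
    proof -
      have "(\<Sum>i\<in>set xs. \<omega> i * (e(x := y)) i) = (\<Sum>i\<in>set xs. \<omega> i * e i)"
        by (rule sum.cong) (use Cons.prems in auto)
      then show ?thesis using Cons.prems by simp
    qed
    then show ?thesis
      using Cons.IH[of "\<lambda>z. f (z + \<omega> x * y)"] Cons.prems
      by (simp only: integral_map_pmf distinct.simps)
  qed
  have "measure_pmf.expectation (rademacher \<bind> ?Q) (\<lambda>e. f (\<Sum>i\<in>set (x # xs). \<omega> i * e i))
      = (\<Sum>y\<in>{-1, 1}. pmf rademacher y *\<^sub>R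
           measure_pmf.expectation (?Q y) (\<lambda>e. f (\<Sum>i\<in>set (x # xs). \<omega> i * e i)))"
    by (rule pmf_expectation_bind) (use fin in \<open>auto simp: rademacher_def\<close>)
  also have "\<dots> = signed_mean (map \<omega> (x # xs)) f"
    unfolding coord by (simp add: rademacher_def field_simps)
  finally show ?case unfolding eq .
qed simp

lemma K_eq_signed_mean: "K n \<omega> = signed_mean (map \<omega> [1..<Suc n]) abs"
  using expectation_signed_sum[of "[1..<Suc n]" abs \<omega>]
  by (simp add: K_def atLeastLessThanSuc_atLeastAtMost del: upt_Suc)

text \<open>The shift \<open>c\<close> makes the induction go through: conditioning on a sign adds \<open>\<plusminus> \<omega> x\<close> to it.\<close>
lemma continuous_on_signed_mean:
  fixes c :: "(nat \<Rightarrow> real) \<Rightarrow> real"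
  assumes "continuous_on UNIV c"
  shows "continuous_on UNIV (\<lambda>\<omega>. signed_mean (map \<omega> xs) (\<lambda>z. \<bar>z + c \<omega>\<bar>))"
  using assms
proof (induction xs arbitrary: c)
  case Nil
  then show ?case by (auto intro!: continuous_intros)
next
  case (Cons x xs)
  have e: "(\<lambda>z. \<bar>z + w + c \<omega>\<bar>) = (\<lambda>z. \<bar>z + (c \<omega> + w)\<bar>)"
    "(\<lambda>z. \<bar>z - w + c \<omega>\<bar>) = (\<lambda>z. \<bar>z + (c \<omega> - w)\<bar>)" for w \<omega>
    by (auto simp: algebra_simps)
  show ?case
    unfolding list.map signed_mean.simps e
    by (intro continuous_intros Cons) (auto intro!: continuous_intros Cons.prems)
qed

lemma continuous_on_K: "continuous_on S (K n)"
  using continuous_on_signed_mean[of "\<lambda>_. 0" "[1..<Suc n]"]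
  by (auto simp: K_eq_signed_mean[abs_def] intro: continuous_on_subset simp del: upt_Suc)

text \<open>
  Compactness is taken in the product topology on all functions; outside \<open>{1..n}\<close> the elements of
  \<open>C n \<tau>\<close> all take the value \<open>undefined\<close>, so the set is a closed subset of a product of compact sets.
\<close>
lemma compact_C: "compact (C n \<tau>)"
proof -
  define B :: "(nat \<Rightarrow> real) set" where "B = PiE UNIV (\<lambda>i. if i \<in> {1..n} then {-1..1} else {undefined})"
  have "compactin (product_topology (\<lambda>_. euclidean) UNIV) B"
    unfolding B_def compactin_PiE by auto
  then have "compact B" by (simp add: euclidean_product_topology)
  define T :: "(nat \<Rightarrow> real) set" where
    "T = {\<omega>. L2_set \<omega> {1..n} = 1} \<inter> (\<Inter>i\<in>{1..<n}. {\<omega>. \<omega> (i + 1) \<le> \<omega> i}) \<inter> {\<omega>. 0 \<le> \<omega> n}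
      \<inter> {\<omega>. L2_set (\<lambda>i. \<omega> i - omega_star i) {1..n} = \<tau>}"
  have "closed T" unfolding T_def L2_set_def
    by (intro closed_Int closed_INT ballI closed_Collect_eq closed_Collect_le continuous_intros) auto
  moreover have "C n \<tau> = B \<inter> T"
  proof -
    have "\<bar>\<omega> i\<bar> \<le> L2_set \<omega> {1..n}" if "i \<in> {1..n}" for \<omega> i
      using member_le_L2_set[of "{1..n}" i "\<lambda>i. \<bar>\<omega> i\<bar>"] that by (simp add: L2_set_def)
    then have "-1 \<le> \<omega> i \<and> \<omega> i \<le> 1" if "i \<in> {1..n}" "L2_set \<omega> {1..n} = 1" for \<omega> i
      using that by (metis abs_le_iff minus_le_iff)
    then show ?thesis
      by (auto simp: C_def B_def T_def proper_unit_vector_def PiE_def Pi_def extensional_def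
         split: if_splits)
  qed
  ultimately show ?thesis using \<open>compact B\<close> by (simp add: compact_Int_closed)
qed

text \<open>The amount by which \<open>\<omega> 1 + \<omega> 2\<close> falls short of \<open>1\<close> at distance \<open>d_max_4 + \<epsilon>\<close>.\<close>
definition gap :: "real \<Rightarrow> real" where
  "gap \<epsilon> = (2 * d_max_4 * \<epsilon> + \<epsilon>\<^sup>2) / sqrt 2"

lemma mem_C_iff:
  assumes "2 \<le> n" "0 \<le> \<epsilon>"
  shows "\<omega> \<in> C n (d_max_4 + \<epsilon>) \<longleftrightarrow> proper_unit_vector n \<omega> \<and> \<omega> 1 + \<omega> 2 = 1 - gap \<epsilon>"
proof -
  have d: "0 \<le> d_max_4" "d_max_4\<^sup>2 = 2 - sqrt 2"
    using sqrt2_less_2 by (simp_all add: d_max_4_def)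
  have "L2_set (\<lambda>i. \<omega> i - omega_star i) {1..n} = d_max_4 + \<epsilon> \<longleftrightarrow> \<omega> 1 + \<omega> 2 = 1 - gap \<epsilon>"
    if "L2_set \<omega> {1..n} = 1"
  proof -
    have set: "{1..n} = insert 1 (insert 2 {3..n})" using assms by auto
    have tail: "(\<Sum>i\<in>{3..n}. (\<omega> i - omega_star i)\<^sup>2) = (\<Sum>i\<in>{3..n}. (\<omega> i)\<^sup>2)"
      by (rule sum.cong) (auto simp: omega_star_def)
    have "(\<Sum>i\<in>{1..n}. (\<omega> i)\<^sup>2) = 1" using that by (simp add: L2_set_def)
    then have "(\<Sum>i\<in>{1..n}. (\<omega> i - omega_star i)\<^sup>2) = 2 - sqrt 2 * (\<omega> 1 + \<omega> 2)"
      unfolding set using tail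
      by (simp add: omega_star_def power2_diff power_divide real_div_sqrt algebra_simps)
    then have "L2_set (\<lambda>i. \<omega> i - omega_star i) {1..n} = sqrt (2 - sqrt 2 * (\<omega> 1 + \<omega> 2))"
      by (simp only: L2_set_def)
    moreover have "d_max_4 + \<epsilon> = sqrt ((d_max_4 + \<epsilon>)\<^sup>2)"
      using d assms by simp
    moreover have "(d_max_4 + \<epsilon>)\<^sup>2 = 2 - sqrt 2 * (1 - gap \<epsilon>)"
      by (simp add: gap_def power2_sum d right_diff_distrib)
    ultimately have "L2_set (\<lambda>i. \<omega> i - omega_star i) {1..n} = d_max_4 + \<epsilon> \<longleftrightarrow>
        2 - sqrt 2 * (\<omega> 1 + \<omega> 2) = 2 - sqrt 2 * (1 - gap \<epsilon>)"
      by (metis real_sqrt_eq_iff)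
    then show ?thesis by simp
  qed
  then show ?thesis by (auto simp: C_def proper_unit_vector_def)
qed

lemma proper_unit_vector_antimono:
  assumes "proper_unit_vector n \<omega>" "1 \<le> i" "i \<le> j" "j \<le> n"
  shows "\<omega> j \<le> \<omega> i"
  using assms(3,4)
proof (induction j rule: dec_induct)
  case (step m)
  have "\<omega> (m + 1) \<le> \<omega> m" using assms(1,2) step by (auto simp: proper_unit_vector_def)
  then show ?case using step by simp
qed simp

lemma sum_squares_eq_sum_list:
  "(\<Sum>i\<in>{1..n}. (\<omega> i)\<^sup>2) = (\<Sum>w\<leftarrow>map \<omega> [1..<Suc n]. w\<^sup>2)" for \<omega> :: "nat \<Rightarrow> real"
  by (simp add: interv_sum_list_conv_sum_set_nat o_def atLeastLessThanSuc_atLeastAtMost del: upt_Suc)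

section \<open>Matching bounds for the minimum\<close>

text \<open>
  Away from the extremal vector the constant gain \<open>\<kappa>\<close> exceeds \<open>3/8 sqrt \<delta>\<close> once \<open>\<delta> \<le> \<kappa>\<^sup>2\<close>, so
  the bound valid near that vector holds everywhere.
\<close>
lemma K_lower_bound:
  assumes "4 \<le> n"
  obtains \<delta>\<^sub>0 where "0 < \<delta>\<^sub>0"
    "\<And>\<delta> \<omega>. 0 \<le> \<delta> \<Longrightarrow> \<delta> \<le> \<delta>\<^sub>0 \<Longrightarrow> proper_unit_vector n \<omega> \<Longrightarrow> \<omega> 1 + \<omega> 2 = 1 - \<delta>
       \<Longrightarrow> 3 / 4 + 3 / 8 * sqrt \<delta> - 9 / 4 * \<delta> \<le> K n \<omega>"
proof
  define \<kappa> :: real where "\<kappa> = 1 / (1200 * 2 ^ (n - 4 + 2))"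
  have \<kappa>: "0 < \<kappa>" by (simp add: \<kappa>_def)
  show "0 < min (1 / 72) (\<kappa>\<^sup>2)" using \<kappa> by simp
  fix \<delta> \<omega>
  assume \<delta>: "0 \<le> \<delta>" "\<delta> \<le> min (1 / 72) (\<kappa>\<^sup>2)"
    and \<omega>: "proper_unit_vector n \<omega>" and sum: "\<omega> 1 + \<omega> 2 = 1 - \<delta>"
  define r where "r = map \<omega> [5..<Suc n]"
  have "[1..<Suc n] = [1..<5] @ [5..<Suc n]"
    using upt_add_eq_append[of 1 5 "Suc n - 5"] assms by (simp del: upt_Suc)
  then have list: "map \<omega> [1..<Suc n] = \<omega> 1 # \<omega> 2 # \<omega> 3 # \<omega> 4 # r"
    by (simp add: r_def upt_rec[of "Suc 0" 5] numeral_2_eq_2[symmetric] del: upt_Suc)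
  have len: "length r = n - 4" by (simp add: r_def del: upt_Suc)
  have order: "\<omega> 2 \<le> \<omega> 1" "\<omega> 3 \<le> \<omega> 2" "\<omega> 4 \<le> \<omega> 3"
    using proper_unit_vector_antimono[OF \<omega>] assms by auto
  have nonneg: "0 \<le> \<omega> i" if "1 \<le> i" "i \<le> n" for i
    using proper_unit_vector_antimono[OF \<omega>, of i n] that \<omega> by (auto simp: proper_unit_vector_def)
  have r: "0 \<le> w \<and> w \<le> \<omega> 4" if "w \<in> set r" for w
    using that nonneg proper_unit_vector_antimono[OF \<omega>, of 4] by (auto simp: r_def)
  have "(\<Sum>i\<in>{1..n}. (\<omega> i)\<^sup>2) = 1" using \<omega> by (simp add: proper_unit_vector_def L2_set_def)
  then have norm: "(\<omega> 1)\<^sup>2 + (\<omega> 2)\<^sup>2 + (\<omega> 3)\<^sup>2 + (\<omega> 4)\<^sup>2 + (\<Sum>w\<leftarrow>r. w\<^sup>2) = 1"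
    unfolding sum_squares_eq_sum_list list by simp
  show "3 / 4 + 3 / 8 * sqrt \<delta> - 9 / 4 * \<delta> \<le> K n \<omega>"
    unfolding K_eq_signed_mean list
  proof (cases "2 - (\<omega> 1 + \<omega> 2 + \<omega> 3 + \<omega> 4) \<le> 1 / 18")
    case True
    then show "3 / 4 + 3 / 8 * sqrt \<delta> - 9 / 4 * \<delta> \<le> signed_mean (\<omega> 1 # \<omega> 2 # \<omega> 3 # \<omega> 4 # r) abs"
      using order \<delta> sum norm by (intro near_lower_bound) auto
  next
    case False
    have "sqrt \<delta> \<le> \<kappa>" using \<delta> \<kappa> by (intro real_le_lsqrt) auto
    moreover have "3 / 4 - \<delta> / 2 + \<kappa> \<le> signed_mean (\<omega> 1 # \<omega> 2 # \<omega> 3 # \<omega> 4 # r) abs"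
      unfolding \<kappa>_def len[symmetric]
      using False order \<delta> sum norm r nonneg[of 4] assms by (intro far_lower_bound) auto
    ultimately show "3 / 4 + 3 / 8 * sqrt \<delta> - 9 / 4 * \<delta> \<le> signed_mean (\<omega> 1 # \<omega> 2 # \<omega> 3 # \<omega> 4 # r) abs"
      using \<delta>(1) real_sqrt_ge_zero[OF \<delta>(1)] \<kappa> by argo
  qed
qed

lemma signed_mean_zeros: "signed_mean (replicate k 0) f = f 0"
  by (induction k arbitrary: f) simp_all

text \<open>
  As \<open>t \<le> b\<close>, the small weights only matter when the four signs in front of \<open>b\<close> cancel; the mean is
  then \<open>E\<bar>t \<epsilon>\<^sub>5 + t \<epsilon>\<^sub>6\<bar> = t\<close>, which is Szarek's bound with equality.
\<close>
lemma signed_mean_extremal: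
  assumes "0 \<le> t" "t \<le> b"
  shows "signed_mean (b # b # b # b # t # t # replicate k 0) abs = 3 / 2 * b + 3 / 8 * t"
  using assms by (simp add: signed_mean_zeros abs_of_nonneg abs_of_nonpos) argo

lemma K_upper_bound:
  assumes "6 \<le> n" "0 \<le> \<delta>" "\<delta> \<le> 1 / 10"
  obtains \<omega> where "proper_unit_vector n \<omega>" "\<omega> 1 + \<omega> 2 = 1 - \<delta>" "K n \<omega> \<le> 3 / 4 + 3 / 8 * sqrt \<delta>"
proof
  define b t where "b = (1 - \<delta>) / 2" and "t = sqrt ((2 * \<delta> - \<delta>\<^sup>2) / 2)"
  define \<omega> :: "nat \<Rightarrow> real" where
    "\<omega> i = (if i \<in> {1..4} then b else if i \<in> {5, 6} then t else if i \<in> {7..n} then 0 else undefined)" for i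
  have \<delta>2: "\<delta>\<^sup>2 \<le> 2 * \<delta>" using assms by (simp add: power2_eq_square mult_right_mono)
  then have t: "0 \<le> t" "t\<^sup>2 = (2 * \<delta> - \<delta>\<^sup>2) / 2" by (simp_all add: t_def)
  have tb: "t \<le> b"
    unfolding t_def
  proof (rule real_le_lsqrt)
    have "b\<^sup>2 = (1 - 2 * \<delta> + \<delta>\<^sup>2) / 4" by (simp add: b_def power2_eq_square field_simps)
    then show "(2 * \<delta> - \<delta>\<^sup>2) / 2 \<le> b\<^sup>2" using zero_le_power2[of \<delta>] assms by argo
  qed (use assms in \<open>simp add: b_def\<close>)
  have "t \<le> sqrt \<delta>" unfolding t_def by (intro real_sqrt_le_mono) (simp add: field_simps)
  have list: "map \<omega> [1..<Suc n] = b # b # b # b # t # t # replicate (n - 6) 0"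
  proof -
    have "[1..<Suc n] = [1..<7] @ [7..<Suc n]"
      using upt_add_eq_append[of 1 7 "Suc n - 7"] assms by (simp del: upt_Suc)
    moreover have "map \<omega> [7..<Suc n] = replicate (n - 6) 0"
      by (rule replicate_eqI) (auto simp: \<omega>_def simp del: upt_Suc)
    ultimately show ?thesis by (simp add: \<omega>_def upt_rec[of "Suc 0" 7] numeral_2_eq_2[symmetric] del: upt_Suc)
  qed
  have "(\<Sum>i\<in>{1..n}. (\<omega> i)\<^sup>2) = 4 * b\<^sup>2 + 2 * t\<^sup>2"
    unfolding sum_squares_eq_sum_list list by (simp add: sum_list_replicate)
  also have "\<dots> = 1" unfolding t(2) by (simp add: b_def power2_eq_square field_simps)
  finally show "proper_unit_vector n \<omega>"
    using assms t tb by (auto simp: proper_unit_vector_def L2_set_def \<omega>_def extensional_def)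
  show "\<omega> 1 + \<omega> 2 = 1 - \<delta>" by (simp add: \<omega>_def b_def)
  show "K n \<omega> \<le> 3 / 4 + 3 / 8 * sqrt \<delta>"
    unfolding K_eq_signed_mean list signed_mean_extremal[OF t(1) tb]
    using \<open>t \<le> sqrt \<delta>\<close> assms(2) unfolding b_def by argo
qed

text \<open>
  Since \<open>\<kappa>\<^sup>2 = sqrt 2 * d_max_4\<close>, the gap is \<open>\<kappa>\<^sup>2 \<epsilon> + \<epsilon>\<^sup>2 / sqrt 2\<close>, whose root lies between
  \<open>\<kappa> sqrt \<epsilon>\<close> and \<open>\<kappa> sqrt \<epsilon> + \<epsilon>\<close>.
\<close>
lemma gap_bounds:
  assumes "0 \<le> \<epsilon>" "\<epsilon> \<le> 1"
  defines "\<kappa> \<equiv> root 4 (4 - 2 * sqrt 2)"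
  shows "0 \<le> gap \<epsilon>" "gap \<epsilon> \<le> 3 * \<epsilon>"
    "\<kappa> * sqrt \<epsilon> \<le> sqrt (gap \<epsilon>)" "sqrt (gap \<epsilon>) \<le> \<kappa> * sqrt \<epsilon> + \<epsilon>"
proof -
  have s: "0 \<le> 4 - 2 * sqrt 2" using sqrt2_less_2 by simp
  have d: "0 \<le> d_max_4" "d_max_4\<^sup>2 = 2 - sqrt 2"
    using sqrt2_less_2 by (simp_all add: d_max_4_def)
  have \<kappa>: "0 \<le> \<kappa>" using s by (simp add: \<kappa>_def)
  have \<kappa>4: "(\<kappa>\<^sup>2)\<^sup>2 = 4 - 2 * sqrt 2"
    using real_root_pow_pos2[of 4 "4 - 2 * sqrt 2"] s by (simp add: \<kappa>_def flip: power_mult)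
  have "(\<kappa>\<^sup>2)\<^sup>2 = (sqrt 2 * d_max_4)\<^sup>2" unfolding \<kappa>4 by (simp add: power_mult_distrib d)
  then have \<kappa>2: "\<kappa>\<^sup>2 = sqrt 2 * d_max_4"
    by (rule power2_eq_imp_eq) (use d in simp_all)
  have gap: "gap \<epsilon> = \<kappa>\<^sup>2 * \<epsilon> + \<epsilon>\<^sup>2 / sqrt 2"
    unfolding \<kappa>2 gap_def by (simp add: field_simps)
  have q: "0 \<le> \<epsilon>\<^sup>2 / sqrt 2" "\<epsilon>\<^sup>2 / sqrt 2 \<le> \<epsilon>\<^sup>2" by (simp_all add: divide_le_eq mult_left_le_one_le mult_le_cancel_left1)
  have "(\<kappa>\<^sup>2)\<^sup>2 \<le> 2\<^sup>2" unfolding \<kappa>4 by simp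
  then have "\<kappa>\<^sup>2 \<le> 2" by (rule power2_le_imp_le) simp
  then have "\<kappa>\<^sup>2 * \<epsilon> \<le> 2 * \<epsilon>" using assms by (intro mult_right_mono)
  moreover have "\<epsilon>\<^sup>2 \<le> \<epsilon>" using assms by (simp add: power2_eq_square mult_left_le)
  ultimately show "gap \<epsilon> \<le> 3 * \<epsilon>" using q unfolding gap by linarith
  show "0 \<le> gap \<epsilon>" using q assms unfolding gap by simp
  show "\<kappa> * sqrt \<epsilon> \<le> sqrt (gap \<epsilon>)"
    using q assms unfolding gap by (intro real_le_rsqrt) (simp add: power_mult_distrib)
  have "\<epsilon>\<^sup>2 / sqrt 2 \<le> \<epsilon>\<^sup>2 + 2 * \<kappa> * sqrt \<epsilon> * \<epsilon>" using q \<kappa> assms by (simp add: add_increasing2)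
  then show "sqrt (gap \<epsilon>) \<le> \<kappa> * sqrt \<epsilon> + \<epsilon>"
    using \<kappa> assms unfolding gap
    by (intro real_le_lsqrt) (simp_all add: power2_sum power_mult_distrib)
qed

theorem corollary2:
  fixes n :: nat
  assumes "n \<ge> 6"
  shows "(\<forall>\<^sub>F \<epsilon> in at_right 0. \<exists>\<omega>. is_arg_min (K n) (\<lambda>\<omega>. \<omega> \<in> C n (d_max_4 + \<epsilon>)) \<omega>) \<and>
         (\<lambda>\<epsilon>. (INF \<omega>\<in>C n (d_max_4 + \<epsilon>). K n \<omega>)
               - (3 / 4 + 3 * root 4 (4 - 2 * sqrt 2) / 8 * sqrt \<epsilon>))
           \<in> O[at_right 0](\<lambda>\<epsilon>. \<epsilon>)"
proof -
  obtain \<delta>\<^sub>0 where "0 < \<delta>\<^sub>0" and lower: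
    "\<And>\<delta> \<omega>. 0 \<le> \<delta> \<Longrightarrow> \<delta> \<le> \<delta>\<^sub>0 \<Longrightarrow> proper_unit_vector n \<omega> \<Longrightarrow> \<omega> 1 + \<omega> 2 = 1 - \<delta>
       \<Longrightarrow> 3 / 4 + 3 / 8 * sqrt \<delta> - 9 / 4 * \<delta> \<le> K n \<omega>"
    using K_lower_bound[of n] assms by auto
  define \<epsilon>\<^sub>0 where "\<epsilon>\<^sub>0 = min 1 (min \<delta>\<^sub>0 (1 / 10) / 3)"
  \<comment> \<open>Both bounds apply when \<open>gap \<epsilon> \<le> min \<delta>\<^sub>0 (1 / 10)\<close>, and \<open>gap \<epsilon> \<le> 3 * \<epsilon>\<close>.\<close>
  let ?main = "\<lambda>\<epsilon>. 3 / 4 + 3 * root 4 (4 - 2 * sqrt 2) / 8 * sqrt \<epsilon>"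
  have core: "(\<exists>\<omega>. is_arg_min (K n) (\<lambda>\<omega>. \<omega> \<in> C n (d_max_4 + \<epsilon>)) \<omega>) \<and>
      \<bar>(INF \<omega>\<in>C n (d_max_4 + \<epsilon>). K n \<omega>) - ?main \<epsilon>\<bar> \<le> 7 * \<epsilon>"
    if \<epsilon>: "0 < \<epsilon>" "\<epsilon> < \<epsilon>\<^sub>0" for \<epsilon>
  proof -
    have mem: "\<omega> \<in> C n (d_max_4 + \<epsilon>) \<longleftrightarrow> proper_unit_vector n \<omega> \<and> \<omega> 1 + \<omega> 2 = 1 - gap \<epsilon>" for \<omega>
      using mem_C_iff \<epsilon> assms by simp
    have g: "0 \<le> gap \<epsilon>" "gap \<epsilon> \<le> 3 * \<epsilon>"
      "root 4 (4 - 2 * sqrt 2) * sqrt \<epsilon> \<le> sqrt (gap \<epsilon>)"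
      "sqrt (gap \<epsilon>) \<le> root 4 (4 - 2 * sqrt 2) * sqrt \<epsilon> + \<epsilon>"
      using gap_bounds[of \<epsilon>] \<epsilon> by (simp_all add: \<epsilon>\<^sub>0_def)
    have small: "gap \<epsilon> \<le> \<delta>\<^sub>0" "gap \<epsilon> \<le> 1 / 10"
      using g(2) \<epsilon> by (auto simp: \<epsilon>\<^sub>0_def)
    obtain \<omega>\<^sub>1 where \<omega>\<^sub>1: "\<omega>\<^sub>1 \<in> C n (d_max_4 + \<epsilon>)" "K n \<omega>\<^sub>1 \<le> 3 / 4 + 3 / 8 * sqrt (gap \<epsilon>)"
      using K_upper_bound[OF assms g(1) small(2)] mem by metis
    then obtain \<omega>\<^sub>2 where \<omega>\<^sub>2: "\<omega>\<^sub>2 \<in> C n (d_max_4 + \<epsilon>)"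
        "\<And>\<omega>. \<omega> \<in> C n (d_max_4 + \<epsilon>) \<Longrightarrow> K n \<omega>\<^sub>2 \<le> K n \<omega>"
      using continuous_attains_inf[OF compact_C _ continuous_on_K, of n "d_max_4 + \<epsilon>" n] by blast
    have "(INF \<omega>\<in>C n (d_max_4 + \<epsilon>). K n \<omega>) = K n \<omega>\<^sub>2"
      using \<omega>\<^sub>2 by (intro cInf_eq_minimum) auto
    moreover have "3 / 4 + 3 / 8 * sqrt (gap \<epsilon>) - 9 / 4 * gap \<epsilon> \<le> K n \<omega>\<^sub>2"
      using lower[OF g(1) small(1)] \<omega>\<^sub>2(1) mem by blast
    moreover have "K n \<omega>\<^sub>2 \<le> 3 / 4 + 3 / 8 * sqrt (gap \<epsilon>)" using \<omega>\<^sub>2(2)[OF \<omega>\<^sub>1(1)] \<omega>\<^sub>1(2) by simp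
    ultimately have "\<bar>(INF \<omega>\<in>C n (d_max_4 + \<epsilon>). K n \<omega>) - ?main \<epsilon>\<bar> \<le> 7 * \<epsilon>"
      using g \<epsilon>(1) by (simp add: abs_le_iff)
    moreover have "is_arg_min (K n) (\<lambda>\<omega>. \<omega> \<in> C n (d_max_4 + \<epsilon>)) \<omega>\<^sub>2"
      using \<omega>\<^sub>2 by (auto simp: is_arg_min_def not_less)
    ultimately show ?thesis by blast
  qed
  have "0 < \<epsilon>\<^sub>0" using \<open>0 < \<delta>\<^sub>0\<close> by (simp add: \<epsilon>\<^sub>0_def)
  then have ev: "\<forall>\<^sub>F \<epsilon> in at_right 0. 0 < \<epsilon> \<and> \<epsilon> < \<epsilon>\<^sub>0"
    by (auto simp: eventually_at_right_field)
  show ?thesis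
  proof
    show "\<forall>\<^sub>F \<epsilon> in at_right 0. \<exists>\<omega>. is_arg_min (K n) (\<lambda>\<omega>. \<omega> \<in> C n (d_max_4 + \<epsilon>)) \<omega>"
      using ev by eventually_elim (use core in blast)
    show "(\<lambda>\<epsilon>. (INF \<omega>\<in>C n (d_max_4 + \<epsilon>). K n \<omega>) - ?main \<epsilon>) \<in> O[at_right 0](\<lambda>\<epsilon>. \<epsilon>)"
    proof (rule bigoI[of _ 7])
      show "\<forall>\<^sub>F \<epsilon> in at_right 0. norm ((INF \<omega>\<in>C n (d_max_4 + \<epsilon>). K n \<omega>) - ?main \<epsilon>) \<le> 7 * norm \<epsilon>"
        using ev by eventually_elim (use core in auto)
    qed
  qed
qed

end
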